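(* The category of finite-dimensional unital $C^*$-algebras and Schwarz-positive unital (SPU) maps is causal. Explicitly: SPU maps are $*$-preserving, and if $F:\mathcal{A}_1\to\mathcal{A}_0$, $G:\mathcal{A}_2\to\mathcal{A}_1$ and $H,K:\mathcal{A}_3\to\mathcal{A}_2$ are SPU maps between finite-dimensional unital $C^*$-algebras satisfying $$F\Big(G\big(AH(B)\big)\Big)=F\Big(G\big(AK(B)\big)\Big)\qquad\text{for all }A\in\mathcal{A}_2,\ B\in\mathcal{A}_3,$$ then $$F\Big(C\,G\big(AH(B)\big)\Big)=F\Big(C\,G\big(AK(B)\big)\Big)\qquad\text{for all }C\in\mathcal{A}_1,\ A\in\mathcal{A}_2,\ B\in\mathcal{A}_3.$$
   Context: A linear map $F:\mathcal{B}\to\mathcal{A}$ of unital $C^*$-algebras is Schwarz-positive unital (SPU) if it is unital and $F(B^*B)\ge F(B)^*F(B)$ for all $B$; it is $*$-preserving if $F(B^* )=F(B)^*$ for all $B$. Abstract notion: in a category with copy morphisms $\Delta_X:X\to X\otimes X$, a subcategory is right causal if for all $f:W\to X$, $g:X\to Y$, $h,k:Y\to Z$ in it with $(\mathrm{id}_Y\otimes h)\Delta_Y g f=(\mathrm{id}_Y\otimes k)\Delta_Y g f$ one has $(\mathrm{id}_X\otimes((\mathrm{id}_Y\otimes h)\Delta_Yg))\Delta_Xf=(\mathrm{id}_X\otimes((\mathrm{id}_Y\otimes k)\Delta_Yg))\Delta_Xf$; left causal is the mirror image; a $*$-preserving subcategory that is right or left causal is called causal. For $C^*$-algebras one works in the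 opposite category with copy given by multiplication, and right causality becomes the explicit condition in the claim. *)

theory Defs
  imports "HOL-Analysis.Analysis"
begin

class scaleC =
  fixes scaleC :: "complex \<Rightarrow> 'a \<Rightarrow> 'a"  (infixr \<open>*\<^sub>C\<close> 75)

class star =
  fixes star :: "'a \<Rightarrow> 'a"  (\<open>(_\<^sup>\<star>)\<close> [1000] 999)

text \<open>
  The unit comes from \<^class>\<open>monoid_mult\<close> rather than \<^class>\<open>real_normed_algebra_1\<close>, since the
  latter demands \<open>0 \<noteq> 1\<close> and would exclude the zero algebra.  The law \<open>1 *\<^sub>C x = x\<close> follows from
  \<open>scaleR_scaleC\<close>; completeness is part of \<^class>\<open>banach\<close>.
\<close>

class unital_cstar_algebra = real_normed_algebra + monoid_mult + banach + scaleC + star +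
  assumes scaleR_scaleC: "scaleR r x = complex_of_real r *\<^sub>C x"
    and scaleC_add_right: "a *\<^sub>C (x + y) = a *\<^sub>C x + a *\<^sub>C y"
    and scaleC_add_left: "(a + b) *\<^sub>C x = a *\<^sub>C x + b *\<^sub>C x"
    and scaleC_scaleC: "a *\<^sub>C (b *\<^sub>C x) = (a * b) *\<^sub>C x"
    and mult_scaleC_left: "(a *\<^sub>C x) * y = a *\<^sub>C (x * y)"
    and mult_scaleC_right: "x * (a *\<^sub>C y) = a *\<^sub>C (x * y)"
    and norm_scaleC: "norm (a *\<^sub>C x) = cmod a * norm x"
    and star_star: "(x\<^sup>\<star>)\<^sup>\<star> = x"
    and star_add: "(x + y)\<^sup>\<star> = x\<^sup>\<star> + y\<^sup>\<star>"
    and star_scaleC: "(a *\<^sub>C x)\<^sup>\<star> = cnj a *\<^sub>C x\<^sup>\<star>"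
    and star_mult: "(x * y)\<^sup>\<star> = y\<^sup>\<star> * x\<^sup>\<star>"
    and cstar_identity: "norm (x\<^sup>\<star> * x) = (norm x)\<^sup>2"

lemma vector_space_scaleC: "vector_space (scaleC :: complex \<Rightarrow> 'a \<Rightarrow> 'a::unital_cstar_algebra)"
proof
  show "1 *\<^sub>C x = x" for x :: 'a
    using scaleR_scaleC[of 1 x] by simp
qed (simp_all add: scaleC_add_right scaleC_add_left scaleC_scaleC)

class fin_dim_cstar_algebra = unital_cstar_algebra +
  assumes finite_spanning: "\<exists>B. finite B \<and> (\<forall>x. \<exists>u. x = (\<Sum>b\<in>B. u b *\<^sub>C b))"

lemma finite_dimensional_scaleC:
  "\<exists>B. finite_dimensional_vector_space (scaleC :: complex \<Rightarrow> 'a \<Rightarrow> 'a::fin_dim_cstar_algebra) B"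
proof -
  interpret vector_space "scaleC :: complex \<Rightarrow> 'a \<Rightarrow> 'a"
    by (rule vector_space_scaleC)
  obtain S :: "'a set" where S: "finite S" "\<forall>x. \<exists>u. x = (\<Sum>b\<in>S. u b *\<^sub>C b)"
    using finite_spanning by blast
  then have "span S = UNIV"
    by (auto simp: span_finite image_def)
  moreover obtain B where B: "B \<subseteq> S" "independent B" "S \<subseteq> span B"
    using maximal_independent_subset[of S] by blast
  ultimately have "span B = UNIV"
    by (metis span_mono span_span top.extremum_uniqueI)
  with B S have "finite_dimensional_vector_space (scaleC :: complex \<Rightarrow> 'a \<Rightarrow> 'a) B"
    by unfold_locales (auto intro: finite_subset)
  then show ?thesis ..
qed

definition cstar_positive :: "'a::unital_cstar_algebra \<Rightarrow> bool" where
  "cstar_positive a \<longleftrightarrow> (\<exists>c. a = c\<^sup>\<star> * c)"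

definition cstar_le :: "'a::unital_cstar_algebra \<Rightarrow> 'a \<Rightarrow> bool"  (infix \<open>\<le>\<^sub>*\<close> 50) where
  "a \<le>\<^sub>* b \<longleftrightarrow> cstar_positive (b - a)"

definition star_preserving :: "('b::unital_cstar_algebra \<Rightarrow> 'a::unital_cstar_algebra) \<Rightarrow> bool" where
  "star_preserving F \<longleftrightarrow> (\<forall>B. F (B\<^sup>\<star>) = (F B)\<^sup>\<star>)"

definition SPU :: "('b::unital_cstar_algebra \<Rightarrow> 'a::unital_cstar_algebra) \<Rightarrow> bool" where
  "SPU F \<longleftrightarrow> Vector_Spaces.linear scaleC scaleC F \<and> F 1 = 1 \<and>
     (\<forall>B. (F B)\<^sup>\<star> * F B \<le>\<^sub>* F (B\<^sup>\<star> * B))"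

instantiation complex :: fin_dim_cstar_algebra
begin

definition scaleC_complex :: "complex \<Rightarrow> complex \<Rightarrow> complex" where
  "scaleC_complex a x = a * x"

definition star_complex :: "complex \<Rightarrow> complex" where
  "star_complex = cnj"

instance
proof
  show "\<exists>B. finite B \<and> (\<forall>x::complex. \<exists>u. x = (\<Sum>b\<in>B. u b *\<^sub>C b))"
    by (rule exI[of _ "{1}"]) (auto simp: scaleC_complex_def)
qed (simp_all add: scaleC_complex_def star_complex_def norm_mult algebra_simps power2_eq_square
    scaleR_conv_of_real)

end

end

theory Submission
  imports Defs "Jordan_Normal_Form.Schur_Decomposition"
begin

text \<open>
  Put \<open>Y = A (H B - K B)\<close>.  The hypothesis with \<open>Y\<^sup>\<star> A\<close> in place of \<open>A\<close> gives \<open>F (G (Y\<^sup>\<star> Y)) = 0\<close>.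
  For every positive functional \<open>\<phi>\<close> the functional \<open>\<phi> \<circ> F\<close> is again positive, so the Schwarz
  inequality for \<open>G\<close> yields \<open>\<phi> (F ((G Y)\<^sup>\<star> G Y)) = 0\<close>, whence \<open>\<phi> (F (C G Y)) = 0\<close> by
  Cauchy--Schwarz.  It remains that positive functionals separate points.  The trace \<open>\<tau>\<close> of the left
  regular representation is positive and faithful: for \<open>a = x + iy\<close> with \<open>x, y\<close> self-adjoint,
  \<open>\<tau> (a\<^sup>\<star> a) = \<tau> (x\<^sup>2) + \<tau> (y\<^sup>2)\<close>, and left multiplication by a self-adjoint element has real
  eigenvalues and is not nilpotent unless the element is zero.  The functionals
  \<open>x \<mapsto> \<tau> (b\<^sup>\<star> x b)\<close> then separate points by polarization.
\<close>

section \<open>Traces of complex matrices\<close>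

definition mat_trace :: "'a::comm_monoid_add mat \<Rightarrow> 'a" where
  "mat_trace A = (\<Sum>i<dim_row A. A $$ (i, i))"

lemma index_mult_mat_sum:
  fixes A B :: "'a::comm_semiring_0 mat"
  assumes "A \<in> carrier_mat m n" "B \<in> carrier_mat n p" "i < m" "j < p"
  shows "(A * B) $$ (i, j) = (\<Sum>k<n. A $$ (i, k) * B $$ (k, j))"
  using assms by (auto simp: scalar_prod_def atLeast0LessThan intro!: sum.cong)

lemma mat_trace_mult_commute:
  fixes A B :: "'a::comm_semiring_0 mat"
  assumes A: "A \<in> carrier_mat m n" and B: "B \<in> carrier_mat n m"
  shows "mat_trace (A * B) = mat_trace (B * A)"
proof -
  have "mat_trace (A * B) = (\<Sum>i<m. \<Sum>k<n. A $$ (i, k) * B $$ (k, i))"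
    using A B by (auto simp: mat_trace_def index_mult_mat_sum[OF A B]
        simp del: index_mult_mat(1) intro!: sum.cong)
  also have "\<dots> = (\<Sum>k<n. \<Sum>i<m. B $$ (k, i) * A $$ (i, k))"
    by (subst sum.swap) (simp add: mult.commute)
  also have "\<dots> = mat_trace (B * A)"
    using A B by (auto simp: mat_trace_def index_mult_mat_sum[OF B A]
        simp del: index_mult_mat(1) intro!: sum.cong)
  finally show ?thesis .
qed

lemma mat_trace_similar:
  fixes A B :: "'a::comm_ring_1 mat"
  assumes "similar_mat A B"
  shows "mat_trace A = mat_trace B"
proof -
  obtain n P Q where c: "A \<in> carrier_mat n n" "B \<in> carrier_mat n n" "P \<in> carrier_mat n n"
      "Q \<in> carrier_mat n n" and QP: "Q * P = 1\<^sub>m n" and A: "A = P * B * Q"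
    using similar_matD[OF assms] by auto
  have "mat_trace A = mat_trace (Q * (P * B))"
    unfolding A by (rule mat_trace_mult_commute) (use c in auto)
  also have "Q * (P * B) = Q * P * B"
    using c by (auto simp: assoc_mult_mat[of _ n n _ n _ n])
  also have "\<dots> = B"
    using c by (simp add: QP)
  finally show ?thesis .
qed

lemma upper_triangular_square_diag:
  fixes B :: "'a::comm_ring_1 mat"
  assumes B: "B \<in> carrier_mat n n" and ut: "upper_triangular B" and i: "i < n"
  shows "(B * B) $$ (i, i) = B $$ (i, i) * B $$ (i, i)"
proof -
  have z: "B $$ (i, k) * B $$ (k, i) = 0" if "k < n" "k \<noteq> i" for k
  proof (cases "k < i")
    case True
    then have "B $$ (i, k) = 0" by (intro upper_triangularD[OF ut]) (use i B in auto)
    then show ?thesis by simp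
  next
    case False
    then have "B $$ (k, i) = 0" by (intro upper_triangularD[OF ut]) (use that B in auto)
    then show ?thesis by simp
  qed
  have "(B * B) $$ (i, i) = (\<Sum>k<n. B $$ (i, k) * B $$ (k, i))"
    by (rule index_mult_mat_sum[OF B B i i])
  also have "\<dots> = (\<Sum>k\<in>{i}. B $$ (i, k) * B $$ (k, i))"
    by (rule sum.mono_neutral_right) (use i z in auto)
  finally show ?thesis by simp
qed

text \<open>Each factor \<open>B\<close> clears one more diagonal. In the sum for entry (i, j) of
  \<open>B ^\<^sub>m Suc k\<close>, terms with l < i + k vanish by induction; otherwise j <= i + k
  <= l and \<open>B $$ (l, j)\<close> is zero. For k = n every position is covered.\<close>

lemma strictly_upper_triangular_pow_index:
  fixes B :: "'a::comm_ring_1 mat"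
  assumes B: "B \<in> carrier_mat n n" and ut: "\<And>i j. j \<le> i \<Longrightarrow> i < n \<Longrightarrow> B $$ (i, j) = 0"
  shows "i < n \<Longrightarrow> j < n \<Longrightarrow> j < i + k \<Longrightarrow> (B ^\<^sub>m k) $$ (i, j) = 0"
proof (induction k arbitrary: i j)
  case 0
  then show ?case using B by auto
next
  case (Suc k)
  have "(B ^\<^sub>m k) $$ (i, l) * B $$ (l, j) = 0" if "l < n" for l
    using that Suc ut[of j l] by (cases "l < i + k") auto
  moreover have "(B ^\<^sub>m Suc k) $$ (i, j) = (\<Sum>l<n. (B ^\<^sub>m k) $$ (i, l) * B $$ (l, j))"
    using index_mult_mat_sum[OF pow_carrier_mat[OF B] B] Suc.prems by simp
  ultimately show ?case
    using Suc.prems by simp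
qed

lemma strictly_upper_triangular_nilpotent:
  fixes B :: "'a::comm_ring_1 mat"
  assumes B: "B \<in> carrier_mat n n" and ut: "\<And>i j. j \<le> i \<Longrightarrow> i < n \<Longrightarrow> B $$ (i, j) = 0"
  shows "B ^\<^sub>m n = 0\<^sub>m n n"
proof (rule eq_matI)
  show "(B ^\<^sub>m n) $$ (i, j) = 0\<^sub>m n n $$ (i, j)" 
    if "i < dim_row (0\<^sub>m n n)" "j < dim_col (0\<^sub>m n n)" for i j
    using strictly_upper_triangular_pow_index[OF B ut, of i j n] that by simp
qed (use B in auto)

text \<open>Triangularization turns the trace of the square into the sum of the squared eigenvalues,
  which are real. If the sum is zero, all eigenvalues vanish and the triangular form is strictly
  upper triangular. As \<open>A\<close> need not be Hermitian, this gives nilpotency rather than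
  \<open>A\<close> = 0.\<close>

lemma mat_trace_square_real_eigenvalues:
  fixes A :: "complex mat"
  assumes A: "A \<in> carrier_mat n n" and real_ev: "\<And>k. eigenvalue A k \<Longrightarrow> k \<in> \<real>"
  shows "mat_trace (A * A) \<in> \<real>\<^sub>\<ge>\<^sub>0"
    and "mat_trace (A * A) = 0 \<Longrightarrow> A ^\<^sub>m n = 0\<^sub>m n n"
proof -
  obtain as where "char_poly A = (\<Prod>a\<leftarrow>as. [:- a, 1:])"
    using char_poly_factorized[OF A] by blast
  then obtain B where B: "B \<in> carrier_mat n n" and ut: "upper_triangular B" and sim: "similar_mat A B"
    using schur_decomposition_exists[OF A] by blast
  obtain P Q where wit: "similar_mat_wit A B P Q"
    using sim by (auto simp: similar_mat_def)
  have P: "P \<in> carrier_mat n n" and Q: "Q \<in> carrier_mat n n"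
    using wit A by (auto simp: similar_mat_wit_def Let_def)
  have real: "B $$ (i, i) \<in> \<real>" if "i < n" for i
  proof -
    \<comment> \<open>Similar matrices share their characteristic polynomial, and that of
      \<open>B\<close> has the diagonal entries as roots.\<close>
    have "poly (char_poly A) (B $$ (i, i)) = 0"
      unfolding char_poly_similar[OF sim] char_poly_upper_triangular[OF B ut] poly_prod_list
      using that B by (auto simp: prod_list_zero_iff diag_mat_def)
    then show ?thesis
      using real_ev eigenvalue_root_char_poly[OF A] by blast
  qed
  have pow: "A ^\<^sub>m k = P * B ^\<^sub>m k * Q" for k
    using similar_mat_wit_pow[OF wit, of k] A by (auto simp: similar_mat_wit_def Let_def)
  have "mat_trace (A * A) = mat_trace (B * B)"
    using similar_mat_wit_pow[OF wit, of 2] A B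
    by (intro mat_trace_similar) (simp add: numeral_2_eq_2 similar_mat_def, blast)
  also have "\<dots> = (\<Sum>i<n. (B $$ (i, i))\<^sup>2)"
    using B by (auto simp: mat_trace_def upper_triangular_square_diag[OF B ut]
        power2_eq_square simp del: index_mult_mat(1) intro!: sum.cong)
  finally have tr: "mat_trace (A * A) = (\<Sum>i<n. (B $$ (i, i))\<^sup>2)" .
  have sq: "(B $$ (i, i))\<^sup>2 = of_real ((Re (B $$ (i, i)))\<^sup>2)" if "i < n" for i
    using real[OF that] by (auto elim!: Reals_cases)
  have tr': "mat_trace (A * A) = of_real (\<Sum>i<n. (Re (B $$ (i, i)))\<^sup>2)"
    by (simp add: tr sq)
  then show "mat_trace (A * A) \<in> \<real>\<^sub>\<ge>\<^sub>0"
    by (simp only: nonneg_Reals_of_real_iff) (simp add: sum_nonneg)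
  assume "mat_trace (A * A) = 0"
  then have "(\<Sum>i<n. (Re (B $$ (i, i)))\<^sup>2) = 0"
    using tr' of_real_eq_0_iff by metis
  then have "Re (B $$ (i, i)) = 0" if "i < n" for i
    using that by (subst (asm) sum_nonneg_eq_0_iff) auto
  then have "B $$ (i, i) = 0" if "i < n" for i
    using that real[of i] by (auto simp: complex_eq_iff complex_is_Real_iff)
  then have "B $$ (i, j) = 0" if "j \<le> i" "i < n" for i j
    using that ut B by (cases "i = j") (auto dest: upper_triangularD)
  then have "B ^\<^sub>m n = 0\<^sub>m n n"
    by (rule strictly_upper_triangular_nilpotent[OF B])
  then show "A ^\<^sub>m n = 0\<^sub>m n n"
    using P Q by (simp add: pow)
qed

section \<open>Elementary consequences of the axioms\<close>

interpretation scaleC: vector_space "scaleC :: complex \<Rightarrow> 'a \<Rightarrow> 'a::unital_cstar_algebra"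
  by (rule vector_space_scaleC)

lemma star_zero [simp]: "(0::'a::unital_cstar_algebra)\<^sup>\<star> = 0"
  using star_add[of 0 "0::'a"] by simp

lemma star_minus: "(- x)\<^sup>\<star> = - ((x::'a::unital_cstar_algebra)\<^sup>\<star>)"
  using star_add[of x "- x"] by (simp add: add_eq_0_iff)

lemma star_diff: "(x - y)\<^sup>\<star> = x\<^sup>\<star> - (y::'a::unital_cstar_algebra)\<^sup>\<star>"
  using star_add[of x "- y"] by (simp add: star_minus)

lemma star_one [simp]: "(1::'a::unital_cstar_algebra)\<^sup>\<star> = 1"
  using star_mult[of "1\<^sup>\<star>" "1::'a"] by (simp add: star_star)

lemma star_power: "(x ^ n)\<^sup>\<star> = ((x::'a::unital_cstar_algebra)\<^sup>\<star>) ^ n"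
  by (induction n) (simp_all add: star_mult power_commutes)

lemma star_mult_self_eq_0_iff [simp]: "x\<^sup>\<star> * x = 0 \<longleftrightarrow> (x::'a::unital_cstar_algebra) = 0"
  using cstar_identity[of x] by auto

text \<open>For self-adjoint x the square of \<open>x ^ 2 ^ k\<close> is its own star times itself,
  so the C*-identity halves the exponent. An arbitrary exponent is first raised to a power of two
  via n < \<open>2 ^ n\<close>.\<close>

lemma selfadjoint_power_eq_0:
  fixes x :: "'a::unital_cstar_algebra"
  assumes x: "x\<^sup>\<star> = x" and "x ^ n = 0"
  shows "x = 0"
proof -
  have *: "x ^ (2 ^ k) = 0 \<Longrightarrow> x = 0" for k
  proof (induction k)
    case (Suc k)
    have "(x ^ 2 ^ k)\<^sup>\<star> * x ^ 2 ^ k = x ^ 2 ^ Suc k"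
      by (simp add: star_power x mult_2 power_add)
    then show ?case
      using Suc by simp
  qed simp
  have "x ^ (2 ^ n) = x ^ n * x ^ (2 ^ n - n)"
    by (metis less_exp less_imp_le le_add_diff_inverse power_add)
  then show ?thesis
    using assms * by simp
qed

lemma cartesian_decomposition:
  fixes a :: "'a::unital_cstar_algebra"
  obtains x y where "x\<^sup>\<star> = x" "y\<^sup>\<star> = y" "a = x + \<i> *\<^sub>C y"
proof
  let ?x = "(1/2) *\<^sub>C (a + a\<^sup>\<star>)" and ?y = "(- \<i>/2) *\<^sub>C (a - a\<^sup>\<star>)"
  show "?x\<^sup>\<star> = ?x"
    by (simp add: star_scaleC star_add star_star add.commute)
  have "?y\<^sup>\<star> = (\<i>/2) *\<^sub>C (a\<^sup>\<star> - a)"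
    by (simp add: star_scaleC star_diff star_minus star_star)
  also have "\<dots> = ?y"
    by (simp add: scaleC.scale_right_diff_distrib)
  finally show "?y\<^sup>\<star> = ?y" .
  have "?x + \<i> *\<^sub>C ?y = (1/2 + 1/2) *\<^sub>C a"
    unfolding scaleC.scale_left_distrib
    by (simp add: scaleC.scale_right_diff_distrib scaleC.scale_right_distrib)
  then show "a = ?x + \<i> *\<^sub>C ?y"
    by simp
qed

section \<open>A faithful positive trace\<close>

text \<open>\<open>M x\<close> is the matrix of left multiplication by x in a basis. The last clause
  turns eigenvectors back into algebra elements, so that reality of eigenvalues can be proved with
  the star alone, without an inner product.\<close>

lemma left_regular_representation:
  obtains n and M :: "'a::fin_dim_cstar_algebra \<Rightarrow> complex mat"
  where "\<And>x. M x \<in> carrier_mat n n" "\<And>x y. M (x + y) = M x + M y"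
    "\<And>c x. M (c *\<^sub>C x) = c \<cdot>\<^sub>m M x" "\<And>x y. M (x * y) = M x * M y"
    "M 1 = 1\<^sub>m n" "\<And>x. M x = 0\<^sub>m n n \<Longrightarrow> x = 0"
    "\<And>x k. eigenvalue (M x) k \<Longrightarrow> \<exists>v. v \<noteq> 0 \<and> x * v = k *\<^sub>C v"
proof -
  obtain B where "finite_dimensional_vector_space (scaleC :: complex \<Rightarrow> 'a \<Rightarrow> 'a) B"
    using finite_dimensional_scaleC by blast
  then interpret finite_dimensional_vector_space "scaleC :: complex \<Rightarrow> 'a \<Rightarrow> 'a" B .
  obtain bs where bs: "set bs = B" "distinct bs"
    using finite_distinct_list[OF finite_Basis] by blast
  define n where "n = length bs"
  define r where "r x i = scaleC.representation B x (bs ! i)" for x i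
  have sum_bs: "(\<Sum>i<n. f (bs ! i)) = sum f B" for f :: "'a \<Rightarrow> 'b::comm_monoid_add"
    using sum.reindex_bij_betw[OF bij_betw_nth[OF bs(2) refl bs(1)[symmetric]], of f]
    by (simp add: n_def)
  have expand: "x = (\<Sum>i<n. r x i *\<^sub>C bs ! i)" for x
    unfolding r_def sum_bs[of "\<lambda>b. scaleC.representation B x b *\<^sub>C b"]
    by (rule scaleC.sum_representation_eq[symmetric]) (auto simp: independent_Basis span_Basis finite_Basis)
  have r_add: "r (x + y) i = r x i + r y i" and r_scale: "r (c *\<^sub>C x) i = c * r x i" for c x y i
    by (simp_all add: r_def scaleC.representation_add scaleC.representation_scale independent_Basis span_Basis)
  have r_zero: "r 0 i = 0" for i
    by (simp add: r_def scaleC.representation_zero)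
  have r_sum: "r (\<Sum>i\<in>I. f i) j = (\<Sum>i\<in>I. r (f i) j)" for I :: "nat set" and f j
    by (induction I rule: infinite_finite_induct) (simp_all add: r_zero r_add)
  have r_basis: "r (bs ! i) j = (if i = j then 1 else 0)" if "i < n" "j < n" for i j
    using that bs by (simp add: r_def scaleC.representation_basis independent_Basis n_def
        nth_mem[of i bs, unfolded bs] nth_eq_iff_index_eq)
  have r_unique: "x = 0" if "\<And>i. i < n \<Longrightarrow> r x i = 0" for x
    using expand[of x] that by simp
  define M where "M x = mat n n (\<lambda>(i, j). r (x * bs ! j) i)" for x
  show ?thesis
  proof
    show M: "M x \<in> carrier_mat n n" for x
      by (simp add: M_def)
    show "M (x + y) = M x + M y" for x y
      by (rule eq_matI) (auto simp: M_def distrib_right r_add)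
    show "M (c *\<^sub>C x) = c \<cdot>\<^sub>m M x" for c x
      by (rule eq_matI) (auto simp: M_def mult_scaleC_left r_scale)
    show "M 1 = 1\<^sub>m n"
      by (rule eq_matI) (auto simp: M_def r_basis)
    \<comment> \<open>\<open>M x\<close> acts on coordinate vectors as x acts on elements.
      Multiplicativity, injectivity and the transfer of eigenvectors all rest on this.\<close>
    have r_mult: "r (x * y) i = (\<Sum>k<n. M x $$ (i, k) * r y k)" if "i < n" for x y i
    proof -
      have "r (x * y) i = r (\<Sum>k<n. r y k *\<^sub>C (x * bs ! k)) i"
        by (subst expand[of y]) (simp add: sum_distrib_left mult_scaleC_right)
      also have "\<dots> = (\<Sum>k<n. M x $$ (i, k) * r y k)"
        using that by (auto simp: r_sum r_scale M_def mult.commute intro!: sum.cong)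
      finally show ?thesis .
    qed
    show "M (x * y) = M x * M y" for x y
    proof (rule eq_matI)
      fix i j assume "i < dim_row (M x * M y)" "j < dim_col (M x * M y)"
      then have ij: "i < n" "j < n" by (auto simp: M_def)
      then have "M (x * y) $$ (i, j) = r (x * (y * bs ! j)) i"
        by (simp add: M_def mult.assoc)
      also have "\<dots> = (\<Sum>k<n. M x $$ (i, k) * M y $$ (k, j))"
        unfolding r_mult[OF ij(1)] by (rule sum.cong) (use ij in \<open>simp_all add: M_def\<close>)
      finally show "M (x * y) $$ (i, j) = (M x * M y) $$ (i, j)"
        using index_mult_mat_sum[OF M[of x] M[of y] ij] by (rule trans[OF _ sym])
    qed (auto simp: M_def)
    show "x = 0" if "M x = 0\<^sub>m n n" for x
    proof (rule r_unique)
      fix i assume i: "i < n"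
      \<comment> \<open>The unit makes the representation injective: \<open>M x\<close> sends the
        coordinates of 1 to those of x.\<close>
      have "r x i = (\<Sum>k<n. 0\<^sub>m n n $$ (i, k) * r 1 k)"
        using r_mult[OF i, of x 1] by (simp only: that mult_1_right)
      also have "\<dots> = 0"
        by (rule sum.neutral) (use i in auto)
      finally show "r x i = 0" .
    qed
    show "\<exists>v. v \<noteq> 0 \<and> x * v = k *\<^sub>C v" if ev: "eigenvalue (M x) k" for x k
    proof -
      obtain w where w: "w \<in> carrier_vec n" "w \<noteq> 0\<^sub>v n" "M x *\<^sub>v w = k \<cdot>\<^sub>v w"
        using ev M[of x] by (auto simp: eigenvalue_def eigenvector_def)
      define v where "v = (\<Sum>i<n. vec_index w i *\<^sub>C bs ! i)"
      have rv: "r v i = vec_index w i" if "i < n" for i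
      proof -
        have "r v i = (\<Sum>j<n. vec_index w j * (if j = i then 1 else 0))"
          using that by (auto simp: v_def r_sum r_scale r_basis intro!: sum.cong)
        then show ?thesis
          using that by (simp add: if_distrib[of "\<lambda>c. _ * c"] cong: if_cong)
      qed
      have "v \<noteq> 0"
      proof
        assume "v = 0"
        then have "vec_index w i = 0" if "i < n" for i
          using rv[OF that] by (simp add: r_zero)
        then have "w = 0\<^sub>v n"
          using w(1) by (intro eq_vecI) auto
        then show False using w by simp
      qed
      moreover have "r (x * v) i = r (k *\<^sub>C v) i" if i: "i < n" for i
      proof -
        have "r (x * v) i = (\<Sum>j<n. M x $$ (i, j) * vec_index w j)"
          using i by (simp add: r_mult rv)
        also have "\<dots> = vec_index (M x *\<^sub>v w) i"
          using i w(1) M[of x] by (auto simp: scalar_prod_def atLeast0LessThan intro!: sum.cong)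
        also have "\<dots> = r (k *\<^sub>C v) i"
          using i w by (simp add: r_scale rv)
        finally show ?thesis .
      qed
      then have "x * v = k *\<^sub>C v"
        using expand[of "x * v"] expand[of "k *\<^sub>C v"] by simp
      ultimately show ?thesis by blast
    qed
  qed
qed

text \<open>The algebra-valued form \<open>v\<^sup>\<star> * (x * v)\<close> replaces the inner
  product: it is self-adjoint and equals k times \<open>v\<^sup>\<star> * v\<close>, which is
  nonzero by the C*-identity.\<close>

lemma selfadjoint_eigenvalue_real:
  fixes x v :: "'a::unital_cstar_algebra"
  assumes "x\<^sup>\<star> = x" "v \<noteq> 0" "x * v = k *\<^sub>C v"
  shows "k \<in> \<real>"
proof -
  have "(v\<^sup>\<star> * (x * v))\<^sup>\<star> = v\<^sup>\<star> * (x * v)"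
    by (simp add: star_mult star_star assms(1) mult.assoc)
  then have "cnj k *\<^sub>C (v\<^sup>\<star> * v) = k *\<^sub>C (v\<^sup>\<star> * v)"
    by (simp add: assms(3) mult_scaleC_right star_scaleC star_mult star_star)
  then show ?thesis
    using assms(2) by (simp add: complex_is_Real_iff complex_eq_iff)
qed

definition positive_functional :: "('a::unital_cstar_algebra \<Rightarrow> complex) \<Rightarrow> bool" where
  "positive_functional \<phi> \<longleftrightarrow> (\<forall>x y. \<phi> (x + y) = \<phi> x + \<phi> y) \<and> (\<forall>c x. \<phi> (c *\<^sub>C x) = c * \<phi> x) \<and>
     (\<forall>x. \<phi> (x\<^sup>\<star> * x) \<in> \<real>\<^sub>\<ge>\<^sub>0)"

lemma faithful_positive_trace:
  obtains \<tau> :: "'a::fin_dim_cstar_algebra \<Rightarrow> complex"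
  where "positive_functional \<tau>" "\<And>x. \<tau> (x\<^sup>\<star> * x) = 0 \<Longrightarrow> x = 0"
proof -
  obtain n and M :: "'a \<Rightarrow> complex mat" where M: "\<And>x. M x \<in> carrier_mat n n"
    and add: "\<And>x y. M (x + y) = M x + M y" and scale: "\<And>c x. M (c *\<^sub>C x) = c \<cdot>\<^sub>m M x"
    and mult: "\<And>x y. M (x * y) = M x * M y" and one: "M 1 = 1\<^sub>m n"
    and inj: "\<And>x. M x = 0\<^sub>m n n \<Longrightarrow> x = 0"
    and ev: "\<And>x k. eigenvalue (M x) k \<Longrightarrow> \<exists>v. v \<noteq> 0 \<and> x * v = k *\<^sub>C v"
    by (rule left_regular_representation[where 'a='a]) (rule that)
  define \<tau> where "\<tau> x = mat_trace (M x)" for x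
  have \<tau>_sum: "\<tau> x = (\<Sum>i<n. M x $$ (i, i))" for x
    using M[of x] by (simp add: \<tau>_def mat_trace_def)
  have \<tau>_add: "\<tau> (x + y) = \<tau> x + \<tau> y" for x y
    using M[of x] M[of y] by (simp add: \<tau>_sum add sum.distrib)
  have \<tau>_scale: "\<tau> (c *\<^sub>C x) = c * \<tau> x" for c x
    using M[of x] by (simp add: \<tau>_sum scale sum_distrib_left)
  have \<tau>_comm: "\<tau> (x * y) = \<tau> (y * x)" for x y
    unfolding \<tau>_def mult by (rule mat_trace_mult_commute[OF M M])
  have M_pow: "M (x ^ k) = M x ^\<^sub>m k" for x k
    using M[of x] by (induction k) (auto simp: one mult power_Suc2 simp del: power_Suc)
  have real_ev: "k \<in> \<real>" if "x\<^sup>\<star> = x" "eigenvalue (M x) k" for x k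
    using ev[OF that(2)] selfadjoint_eigenvalue_real that(1) by blast
  have sa_nonneg: "\<tau> (x * x) \<in> \<real>\<^sub>\<ge>\<^sub>0" if "x\<^sup>\<star> = x" for x
    unfolding \<tau>_def mult by (rule mat_trace_square_real_eigenvalues(1)[OF M real_ev[OF that]])
  have sa_zero: "x = 0" if "x\<^sup>\<star> = x" "\<tau> (x * x) = 0" for x
  proof -
    \<comment> \<open>The matrix is nilpotent, hence so is x, and a nilpotent self-adjoint element
      is zero.\<close>
    have "M (x ^ n) = 0\<^sub>m n n"
      using mat_trace_square_real_eigenvalues(2)[OF M real_ev[OF that(1)]] that(2)
      by (simp add: \<tau>_def mult M_pow)
    then show ?thesis
      using inj selfadjoint_power_eq_0[OF that(1)] by blast
  qed
  have \<tau>_diff: "\<tau> (x - y) = \<tau> x - \<tau> y" for x y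
    using \<tau>_add[of "x - y" y] by simp
  \<comment> \<open>The commutator term of \<open>(x + iy)\<^sup>\<star> (x + iy)\<close> has trace zero.\<close>
  have split: "\<tau> (a\<^sup>\<star> * a) = \<tau> (x * x) + \<tau> (y * y)"
    if "x\<^sup>\<star> = x" "y\<^sup>\<star> = y" "a = x + \<i> *\<^sub>C y" for a x y
    using \<tau>_comm[of x y] that
    by (simp add: star_add star_scaleC distrib_left distrib_right mult_scaleC_left mult_scaleC_right
        scaleC_scaleC scaleC_add_right left_diff_distrib right_diff_distrib
        \<tau>_add \<tau>_scale \<tau>_diff)
  show ?thesis
  proof
    have "\<tau> (a\<^sup>\<star> * a) \<in> \<real>\<^sub>\<ge>\<^sub>0" for a
      by (rule cartesian_decomposition[of a]) (simp add: split sa_nonneg)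
    then show "positive_functional \<tau>"
      by (simp add: positive_functional_def \<tau>_add \<tau>_scale)
    show "a = 0" if "\<tau> (a\<^sup>\<star> * a) = 0" for a
    proof (rule cartesian_decomposition[of a])
      fix x y :: 'a assume xy: "x\<^sup>\<star> = x" "y\<^sup>\<star> = y" "a = x + \<i> *\<^sub>C y"
      then have "\<tau> (x * x) = 0 \<and> \<tau> (y * y) = 0"
        using that split[OF xy] sa_nonneg[OF xy(1)] sa_nonneg[OF xy(2)]
        by (auto simp: complex_nonneg_Reals_iff complex_eq_iff)
      then show "a = 0"
        using sa_zero[of x] sa_zero[of y] xy by simp
    qed
  qed
qed

section \<open>Positive functionals and Schwarz maps\<close>

lemma positive_functionalD:
  assumes "positive_functional \<phi>"
  shows "\<phi> (x + y) = \<phi> x + \<phi> y" "\<phi> (c *\<^sub>C x) = c * \<phi> x" "\<phi> (x\<^sup>\<star> * x) \<in> \<real>\<^sub>\<ge>\<^sub>0"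
  using assms by (auto simp: positive_functional_def)

lemma positive_functional_diff:
  assumes "positive_functional \<phi>"
  shows "\<phi> (x - y) = \<phi> x - \<phi> y"
  using positive_functionalD(1)[OF assms, of "x - y" y] by simp

text \<open>For fixed \<open>X\<close> with \<open>\<phi> (X\<^sup>\<star> X) = 0\<close>, the number \<open>\<phi> ((C\<^sup>\<star> + c X)\<^sup>\<star> (C\<^sup>\<star> + c X))\<close> is affine over the
  reals in \<open>c\<close> and nonnegative, so its linear part vanishes.\<close>

lemma positive_functional_null:
  assumes \<phi>: "positive_functional \<phi>" and null: "\<phi> (X\<^sup>\<star> * X) = 0"
  shows "\<phi> (C * X) = 0"
proof -
  note lin = positive_functionalD(1,2)[OF \<phi>]
  define p q r where "p = \<phi> (C * X)" and "q = \<phi> (X\<^sup>\<star> * C\<^sup>\<star>)" and "r = \<phi> (C * C\<^sup>\<star>)"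
  have nonneg: "r + c * p + cnj c * q \<in> \<real>\<^sub>\<ge>\<^sub>0" for c
    using positive_functionalD(3)[OF \<phi>, of "C\<^sup>\<star> + c *\<^sub>C X"] null
    by (simp add: star_add star_scaleC star_star distrib_left distrib_right mult_scaleC_left
        mult_scaleC_right scaleC_scaleC scaleC_add_right lin p_def q_def r_def algebra_simps)
  have zero: "u = 0" if "\<And>t. r + of_real t * u \<in> \<real>\<^sub>\<ge>\<^sub>0" for u
  proof -
    have re: "Re r + t * Re u \<ge> 0" and im: "Im r + t * Im u = 0" for t
      using that[of t] by (simp_all add: complex_nonneg_Reals_iff)
    have "Re u = 0"
      \<comment> \<open>This t would make the real part equal to -1.\<close>
      using re[of "- (Re r + 1) / Re u"] by (cases "Re u = 0") auto
    moreover have "Im u = 0"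
      using im[of 0] im[of 1] by simp
    ultimately show ?thesis by (simp add: complex_eq_iff)
  qed
  \<comment> \<open>Real c gives p + q = 0 and purely imaginary c gives p = q; together p =
    0.\<close>
  have "p + q = 0"
    by (rule zero) (use nonneg[of "of_real t" for t] in \<open>simp add: algebra_simps\<close>)
  moreover have "\<i> * p - \<i> * q = 0"
    by (rule zero) (use nonneg[of "\<i> * of_real t" for t] in \<open>simp add: algebra_simps\<close>)
  ultimately show ?thesis
    by (simp add: p_def complex_eq_iff)
qed

lemma positive_functionals_separate:
  fixes w :: "'a::fin_dim_cstar_algebra"
  assumes w: "\<And>\<phi>. positive_functional \<phi> \<Longrightarrow> \<phi> w = 0"
  shows "w = 0"
proof -
  obtain \<tau> :: "'a \<Rightarrow> complex" where \<tau>: "positive_functional \<tau>"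
    and faithful: "\<And>x. \<tau> (x\<^sup>\<star> * x) = 0 \<Longrightarrow> x = 0"
    using faithful_positive_trace by blast
  note lin = positive_functionalD(1,2)[OF \<tau>] positive_functional_diff[OF \<tau>]
  have conj_pos: "positive_functional (\<lambda>x. \<tau> (b\<^sup>\<star> * x * b))" for b
  proof -
    have "\<tau> (b\<^sup>\<star> * (x\<^sup>\<star> * x) * b) \<in> \<real>\<^sub>\<ge>\<^sub>0" for x
      using positive_functionalD(3)[OF \<tau>, of "x * b"] by (simp add: star_mult mult.assoc)
    then show ?thesis
      by (simp add: positive_functional_def distrib_left distrib_right mult_scaleC_left
          mult_scaleC_right lin)
  qed
  then have z: "\<tau> (b\<^sup>\<star> * w * b) = 0" for b
    using w by blast
  \<comment> \<open>Polarization: b = 1 and b = w remove the first two terms; b = 1 + w and b = 1 +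
    iw then give the sum and the difference of the two remaining traces.\<close>
  have "\<tau> w + \<tau> (w\<^sup>\<star> * w * w) + \<tau> (w * w) + \<tau> (w\<^sup>\<star> * w) = 0"
    using z[of "1 + w"] by (simp add: star_add distrib_left distrib_right lin algebra_simps)
  moreover have "\<tau> w + \<tau> (w\<^sup>\<star> * w * w) + \<i> * \<tau> (w * w) - \<i> * \<tau> (w\<^sup>\<star> * w) = 0"
    using z[of "1 + \<i> *\<^sub>C w"]
    by (simp add: star_add star_scaleC distrib_left distrib_right mult_scaleC_left mult_scaleC_right
        scaleC_scaleC scaleC_add_right lin algebra_simps)
  ultimately have "\<tau> (w\<^sup>\<star> * w) = 0"
    using z[of 1] z[of w] by (simp add: complex_eq_iff)
  then show ?thesis
    by (rule faithful)
qed

section \<open>SPU maps and right causality\<close>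

lemma SPU_D:
  assumes "SPU F"
  shows "F (x + y) = F x + F y" "F (x - y) = F x - F y" "F (c *\<^sub>C x) = c *\<^sub>C F x" "F 1 = 1"
proof -
  interpret Vector_Spaces.linear scaleC scaleC F
    using assms by (simp add: SPU_def)
  show "F (x + y) = F x + F y" "F (x - y) = F x - F y" "F (c *\<^sub>C x) = c *\<^sub>C F x"
    by (simp_all add: add diff scale)
  show "F 1 = 1"
    using assms by (simp add: SPU_def)
qed

lemma SPU_Schwarz:
  assumes "SPU F"
  obtains c where "F (x\<^sup>\<star> * x) = (F x)\<^sup>\<star> * F x + c\<^sup>\<star> * c"
proof -
  obtain c where "F (x\<^sup>\<star> * x) - (F x)\<^sup>\<star> * F x = c\<^sup>\<star> * c"
    using assms by (auto simp: SPU_def cstar_le_def cstar_positive_def)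
  then have "F (x\<^sup>\<star> * x) = (F x)\<^sup>\<star> * F x + c\<^sup>\<star> * c"
    by (simp add: algebra_simps)
  then show ?thesis ..
qed

text \<open>A self-adjoint \<open>h\<close> satisfies \<open>2h = (h + 1)\<^sup>2 - h\<^sup>2 - 1\<close>, and Schwarz maps send squares of
  self-adjoint elements to self-adjoint elements.\<close>

lemma SPU_star_preserving:
  fixes F :: "'a::unital_cstar_algebra \<Rightarrow> 'b::unital_cstar_algebra"
  assumes F: "SPU F"
  shows "star_preserving F"
proof -
  note lin = SPU_D[OF F]
  have square: "(F (x\<^sup>\<star> * x))\<^sup>\<star> = F (x\<^sup>\<star> * x)" for x
    by (rule SPU_Schwarz[OF F, of x]) (simp add: star_add star_mult star_star)
  have sa: "(F x)\<^sup>\<star> = F x" if "x\<^sup>\<star> = x" for x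
  proof -
    have "(F x + F x)\<^sup>\<star> = F x + F x"
      using square[of "x + 1"] square[of x] that
      by (simp add: star_add distrib_left distrib_right lin algebra_simps)
    moreover have "y + y = 2 *\<^sub>C y" for y :: 'b
      using scaleC_add_left[of 1 1 y] by simp
    ultimately show ?thesis
      by (simp add: star_scaleC)
  qed
  have "F (a\<^sup>\<star>) = (F a)\<^sup>\<star>" for a
    by (rule cartesian_decomposition[of a]) (simp add: star_add star_scaleC lin sa)
  then show ?thesis
    by (simp add: star_preserving_def)
qed

text \<open>By the Schwarz inequality \<open>F (x\<^sup>\<star> * x)\<close> is a sum of two
  elements of the form \<open>c\<^sup>\<star> * c\<close>, on each of which \<open>\<phi>\<close> is
  nonnegative.\<close>

lemma positive_functional_SPU:
  assumes \<phi>: "positive_functional \<phi>" and F: "SPU F"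
  shows "positive_functional (\<lambda>x. \<phi> (F x))"
proof -
  have "\<phi> (F (x\<^sup>\<star> * x)) \<in> \<real>\<^sub>\<ge>\<^sub>0" for x
    by (rule SPU_Schwarz[OF F, of x]) (simp add: positive_functionalD[OF \<phi>])
  then show ?thesis
    by (simp add: positive_functional_def SPU_D[OF F] positive_functionalD[OF \<phi>])
qed

text \<open>The Schwarz inequality splits the null value into two nonnegative numbers, so both are
  zero. Thus \<open>G Y\<close> is a null vector of \<open>\<phi>\<close>, to which Cauchy-Schwarz
  applies.\<close>

lemma positive_functional_SPU_null:
  fixes G :: "'a::unital_cstar_algebra \<Rightarrow> 'b::unital_cstar_algebra"
  assumes \<phi>: "positive_functional \<phi>" and G: "SPU G" and null: "\<phi> (G (Y\<^sup>\<star> * Y)) = 0"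
  shows "\<phi> (C * G Y) = 0"
proof (rule positive_functional_null[OF \<phi>])
  obtain c where "G (Y\<^sup>\<star> * Y) = (G Y)\<^sup>\<star> * G Y + c\<^sup>\<star> * c"
    using SPU_Schwarz[OF G] .
  then show "\<phi> ((G Y)\<^sup>\<star> * G Y) = 0"
    using null positive_functionalD(3)[OF \<phi>, of "G Y"] positive_functionalD(3)[OF \<phi>, of c]
    by (auto simp: positive_functionalD(1)[OF \<phi>] complex_nonneg_Reals_iff complex_eq_iff)
qed

text \<open>The fixed elements h and k stand for \<open>H B\<close> and \<open>K B\<close>. Finite
  dimension of the target of \<open>F\<close> supplies enough positive functionals to test equality
  there.\<close>

lemma SPU_right_causal:
  fixes F :: "'a1::unital_cstar_algebra \<Rightarrow> 'a0::fin_dim_cstar_algebra"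
    and G :: "'a2::unital_cstar_algebra \<Rightarrow> 'a1"
  assumes F: "SPU F" and G: "SPU G" and eq: "\<And>A. F (G (A * h)) = F (G (A * k))"
  shows "F (C * G (A * h)) = F (C * G (A * k))"
proof -
  define Y where "Y = A * (h - k)"
  have "F (G (Y\<^sup>\<star> * Y)) = F (G (Y\<^sup>\<star> * A * h)) - F (G (Y\<^sup>\<star> * A * k))"
    by (simp add: Y_def right_diff_distrib mult.assoc SPU_D[OF F] SPU_D[OF G])
  then have null: "F (G (Y\<^sup>\<star> * Y)) = 0"
    by (simp add: eq)
  have "F (C * G Y) = 0"
  proof (rule positive_functionals_separate)
    fix \<phi> :: "'a0 \<Rightarrow> complex" assume \<phi>: "positive_functional \<phi>"
    have "\<phi> 0 = 0"
      using positive_functionalD(1)[OF \<phi>, of 0 0] by simp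
    then show "\<phi> (F (C * G Y)) = 0"
      \<comment> \<open>The functional used is \<open>\<phi>\<close> composed with \<open>F\<close>,
        so the factor C stays inside \<open>F\<close>.\<close>
      using positive_functional_SPU_null[OF positive_functional_SPU[OF \<phi> F] G] null by simp
  qed
  then show ?thesis
    by (simp add: Y_def right_diff_distrib SPU_D[OF F] SPU_D[OF G])
qed

theorem proposition8p34:
  shows "(\<forall>F :: 'a1::fin_dim_cstar_algebra \<Rightarrow> 'a0::fin_dim_cstar_algebra.
            SPU F \<longrightarrow> star_preserving F) \<and>
         (\<forall>(F :: 'a1 \<Rightarrow> 'a0)
           (G :: 'a2::fin_dim_cstar_algebra \<Rightarrow> 'a1)
           (H :: 'a3::fin_dim_cstar_algebra \<Rightarrow> 'a2)
           (K :: 'a3 \<Rightarrow> 'a2).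
            SPU F \<longrightarrow> SPU G \<longrightarrow> SPU H \<longrightarrow> SPU K \<longrightarrow>
            (\<forall>A B. F (G (A * H B)) = F (G (A * K B))) \<longrightarrow>
            (\<forall>C A B. F (C * G (A * H B)) = F (C * G (A * K B))))"
  using SPU_star_preserving SPU_right_causal by blast

end
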